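(* If $\mathscr{M}=(S,\rho)$ is a matroid scheme with no loops, then the characteristic polynomial of its poset of flats $F=F(\mathscr{M})$ is $\chi_F(t)=(-1)^{\rho(\mathscr{M})}T_{\mathscr{M}}(1-t,0)$.
   Context: Simplicial poset: finite, unique minimum $\hat0$, ranked, each $S_{\le x}$ Boolean on the atoms below $x$; $|x|$ the rank; $x\vee y$/$x\wedge y$ the sets of minimal common upper/maximal common lower bounds. Matroid scheme $(S,\rho)$: $\rho:S\to\mathbb{Z}_{\ge0}$ with (M1) $0\le\rho(x)\le|x|$; (M2) monotone; (M3) $u\in x\vee y\Rightarrow\rho(x)+\rho(y)\ge\rho(u)+\rho(x\wedge y)$; (M4) $\ell\in x\wedge y,\rho(x)=\rho(\ell)\Rightarrow x\vee y\ne\emptyset$; (M5) $\rho(x)<\rho(y)\Rightarrow$ some atom $a\le y$, $a\not\le x$, $x\vee a\ne\emptyset$. $\rho(\mathscr{M})$ is $\rho$ of any maximal element. A loop is an atom $a$ with $\rho(a)=0$. Closure $\mathrm{cl}(x)$: unique maximal $y\ge x$ with $\rho(y)=\rho(x)$; flats: $\mathrm{cl}(x)=x$; $F(\mathscr{M})$ the subposet of flats, ranked by $\rho$, with minimum $\mathrm{cl}(\hat0)$. Tutte polynomial: $T_{\mathscr{M}}(\mathrm{x},\mathrm{y})=\sum_{w\in S}(\mathrm{x}-1)^{\rho(\mathscr{M})-\rho(w)}(\mathrm{y}-1)^{|w|-\rho(w)}$. For a bounded-below ranked poset $(P,\rho)$, the Möbius function $\mu_P$ satisfies $\mu_P(\hat0)=1$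 and $\sum_{u\le w}\mu_P(u)=0$ for $w>\hat0$, and $\chi_P(t)=\sum_{w\in P}\mu_P(w)t^{\rho(P)-\rho(w)}$ where $\rho(P)$ is the rank of $P$ (for $P=F(\mathscr{M})$ this is $\rho(\mathscr{M})$). *)

theory Defs
  imports "HOL-Computational_Algebra.Polynomial"
begin

text \<open>A poset is a carrier set together with an order predicate. Only the behaviour of the
  predicate on the carrier matters, so the subposet on a subset of the carrier uses the
  same predicate.\<close>

locale poset =
  fixes S :: "'a set" and le :: "'a \<Rightarrow> 'a \<Rightarrow> bool"
  assumes refl: "reflp_on S le"
    and trans: "transp_on S le"
    and antisym: "antisymp_on S le"

definition is_bot :: "'a set \<Rightarrow> ('a \<Rightarrow> 'a \<Rightarrow> bool) \<Rightarrow> 'a \<Rightarrow> bool" where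
  "is_bot S le b \<longleftrightarrow> b \<in> S \<and> (\<forall>x\<in>S. le b x)"

definition poset_bot :: "'a set \<Rightarrow> ('a \<Rightarrow> 'a \<Rightarrow> bool) \<Rightarrow> 'a" where
  "poset_bot S le = (THE b. is_bot S le b)"

definition minimals :: "'a set \<Rightarrow> ('a \<Rightarrow> 'a \<Rightarrow> bool) \<Rightarrow> 'a set" where
  "minimals S le = {x \<in> S. \<forall>z\<in>S. le z x \<longrightarrow> z = x}"

definition maximals :: "'a set \<Rightarrow> ('a \<Rightarrow> 'a \<Rightarrow> bool) \<Rightarrow> 'a set" where
  "maximals S le = {x \<in> S. \<forall>z\<in>S. le x z \<longrightarrow> z = x}"

definition joins :: "'a set \<Rightarrow> ('a \<Rightarrow> 'a \<Rightarrow> bool) \<Rightarrow> 'a \<Rightarrow> 'a \<Rightarrow> 'a set" where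
  "joins S le x y = minimals {u \<in> S. le x u \<and> le y u} le"

definition meets :: "'a set \<Rightarrow> ('a \<Rightarrow> 'a \<Rightarrow> bool) \<Rightarrow> 'a \<Rightarrow> 'a \<Rightarrow> 'a set" where
  "meets S le x y = maximals {l \<in> S. le l x \<and> le l y} le"

definition covers :: "'a set \<Rightarrow> ('a \<Rightarrow> 'a \<Rightarrow> bool) \<Rightarrow> 'a \<Rightarrow> 'a \<Rightarrow> bool" where
  "covers S le x y \<longleftrightarrow> x \<in> S \<and> y \<in> S \<and> le x y \<and> x \<noteq> y \<and>
     (\<forall>z\<in>S. le x z \<and> le z y \<longrightarrow> z = x \<or> z = y)"

definition atoms :: "'a set \<Rightarrow> ('a \<Rightarrow> 'a \<Rightarrow> bool) \<Rightarrow> 'a set" where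
  "atoms S le = {a. covers S le (poset_bot S le) a}"

definition atoms_below :: "'a set \<Rightarrow> ('a \<Rightarrow> 'a \<Rightarrow> bool) \<Rightarrow> 'a \<Rightarrow> 'a set" where
  "atoms_below S le x = {a \<in> atoms S le. le a x}"

definition rank_function :: "'a set \<Rightarrow> ('a \<Rightarrow> 'a \<Rightarrow> bool) \<Rightarrow> ('a \<Rightarrow> nat) \<Rightarrow> bool" where
  "rank_function S le r \<longleftrightarrow>
     r (poset_bot S le) = 0 \<and> (\<forall>x y. covers S le x y \<longrightarrow> r y = Suc (r x))"

text \<open>In a finite ranked poset with a minimum all rank functions agree on the carrier
  (lemma \<open>poset_rank_eq\<close> below), so the choice is immaterial there.\<close>

definition poset_rank :: "'a set \<Rightarrow> ('a \<Rightarrow> 'a \<Rightarrow> bool) \<Rightarrow> 'a \<Rightarrow> nat" where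
  "poset_rank S le = (SOME r. rank_function S le r)"

locale simplicial_poset = poset S le
  for S :: "'a set" and le :: "'a \<Rightarrow> 'a \<Rightarrow> bool" +
  assumes finite: "finite S"
    and has_bot: "\<exists>b. is_bot S le b"
    and ranked: "\<exists>r. rank_function S le r"
    and boolean: "\<And>x. x \<in> S \<Longrightarrow>
      bij_betw (atoms_below S le) {y \<in> S. le y x} (Pow (atoms_below S le x)) \<and>
      (\<forall>y\<in>{y \<in> S. le y x}. \<forall>z\<in>{z \<in> S. le z x}.
        le y z \<longleftrightarrow> atoms_below S le y \<subseteq> atoms_below S le z)"

text \<open>If \<open>x\<close> and \<open>y\<close> have a common upper bound \<open>u\<close>, their maximal common lower bound is unique,
  being the meet in the Boolean lattice below \<open>u\<close>. In \<open>M3\<close> this element is \<open>l\<close>.\<close>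

locale matroid_scheme = simplicial_poset S le
  for S :: "'a set" and le :: "'a \<Rightarrow> 'a \<Rightarrow> bool" +
  fixes \<rho> :: "'a \<Rightarrow> nat"
  assumes M1: "x \<in> S \<Longrightarrow> \<rho> x \<le> poset_rank S le x"
    and M2: "x \<in> S \<Longrightarrow> y \<in> S \<Longrightarrow> le x y \<Longrightarrow> \<rho> x \<le> \<rho> y"
    and M3: "x \<in> S \<Longrightarrow> y \<in> S \<Longrightarrow> u \<in> joins S le x y \<Longrightarrow> l \<in> meets S le x y \<Longrightarrow>
      \<rho> x + \<rho> y \<ge> \<rho> u + \<rho> l"
    and M4: "x \<in> S \<Longrightarrow> y \<in> S \<Longrightarrow> l \<in> meets S le x y \<Longrightarrow> \<rho> x = \<rho> l \<Longrightarrow>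
      joins S le x y \<noteq> {}"
    and M5: "x \<in> S \<Longrightarrow> y \<in> S \<Longrightarrow> \<rho> x < \<rho> y \<Longrightarrow>
      \<exists>a\<in>atoms S le. le a y \<and> \<not> le a x \<and> joins S le x a \<noteq> {}"

text \<open>By \<open>M5\<close>, \<open>\<rho>\<close> takes the same value at all maximal elements.\<close>

definition scheme_rank :: "'a set \<Rightarrow> ('a \<Rightarrow> 'a \<Rightarrow> bool) \<Rightarrow> ('a \<Rightarrow> nat) \<Rightarrow> nat" where
  "scheme_rank S le \<rho> = \<rho> (SOME x. x \<in> maximals S le)"

definition loops :: "'a set \<Rightarrow> ('a \<Rightarrow> 'a \<Rightarrow> bool) \<Rightarrow> ('a \<Rightarrow> nat) \<Rightarrow> 'a set" where
  "loops S le \<rho> = {a \<in> atoms S le. \<rho> a = 0}"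

definition closure :: "'a set \<Rightarrow> ('a \<Rightarrow> 'a \<Rightarrow> bool) \<Rightarrow> ('a \<Rightarrow> nat) \<Rightarrow> 'a \<Rightarrow> 'a" where
  "closure S le \<rho> x = (THE y. y \<in> maximals {z \<in> S. le x z \<and> \<rho> z = \<rho> x} le)"

definition flats :: "'a set \<Rightarrow> ('a \<Rightarrow> 'a \<Rightarrow> bool) \<Rightarrow> ('a \<Rightarrow> nat) \<Rightarrow> 'a set" where
  "flats S le \<rho> = {x \<in> S. closure S le \<rho> x = x}"

text \<open>Polynomials in \<open>x\<close> and \<open>y\<close> are represented as polynomials in \<open>y\<close> with coefficients
  in \<open>\<int>[x]\<close>.\<close>

definition varX :: "int poly poly" where "varX = [:[:0, 1:]:]"

definition varY :: "int poly poly" where "varY = [:0, 1:]"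

text \<open>The substitution of \<open>x\<close> by \<open>a\<close> and \<open>y\<close> by \<open>b\<close>, for one-variable polynomials \<open>a\<close> and \<open>b\<close>.\<close>

definition subst2 :: "int poly poly \<Rightarrow> int poly \<Rightarrow> int poly \<Rightarrow> int poly" where
  "subst2 p a b = poly (map_poly (\<lambda>q. pcompose q a) p) b"

text \<open>The subtractions in the exponents are not truncated for a matroid scheme: \<open>\<rho> w\<close> is at most
  the rank of the scheme and, by \<open>M1\<close>, at most the rank of \<open>w\<close>.\<close>

definition tutte_poly :: "'a set \<Rightarrow> ('a \<Rightarrow> 'a \<Rightarrow> bool) \<Rightarrow> ('a \<Rightarrow> nat) \<Rightarrow> int poly poly" where
  "tutte_poly S le \<rho> =
     (\<Sum>w\<in>S. (varX - 1) ^ (scheme_rank S le \<rho> - \<rho> w) * (varY - 1) ^ (poset_rank S le w - \<rho> w))"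

definition is_mobius :: "'a set \<Rightarrow> ('a \<Rightarrow> 'a \<Rightarrow> bool) \<Rightarrow> ('a \<Rightarrow> int) \<Rightarrow> bool" where
  "is_mobius P le f \<longleftrightarrow> f (poset_bot P le) = 1 \<and>
     (\<forall>w\<in>P. w \<noteq> poset_bot P le \<longrightarrow> (\<Sum>u | u \<in> P \<and> le u w. f u) = 0)"

text \<open>The value \<open>0\<close> off the carrier makes the function unique, see \<open>mobius_ex1\<close> below.\<close>

definition mobius :: "'a set \<Rightarrow> ('a \<Rightarrow> 'a \<Rightarrow> bool) \<Rightarrow> 'a \<Rightarrow> int" where
  "mobius P le = (THE f. is_mobius P le f \<and> (\<forall>w. w \<notin> P \<longrightarrow> f w = 0))"

text \<open>The rank function \<open>\<rho>\<close> is part of the data of the ranked poset; the rank of the poset is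
  the largest value of \<open>\<rho>\<close>.\<close>

definition poset_char_poly :: "'a set \<Rightarrow> ('a \<Rightarrow> 'a \<Rightarrow> bool) \<Rightarrow> ('a \<Rightarrow> nat) \<Rightarrow> int poly" where
  "poset_char_poly P le \<rho> = (\<Sum>w\<in>P. monom (mobius P le w) (Max (\<rho> ` P) - \<rho> w))"


context poset
begin

lemma poset_bot_eq: "is_bot S le b \<Longrightarrow> poset_bot S le = b"
  unfolding poset_bot_def
  by (rule the_equality) (auto simp: is_bot_def intro: antisymp_onD[OF antisym])

lemma down_psubset:
  assumes "u \<in> S" "w \<in> S" "le u w" "u \<noteq> w"
  shows "{v \<in> S. le v u} \<subset> {v \<in> S. le v w}"
proof -
  have "\<not> le w u" using antisymp_onD[OF antisym, of u w] assms by blast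
  moreover have "le w w" using reflp_onD[OF refl] assms by blast
  moreover have "le v w" if "v \<in> S" "le v u" for v
    using transp_onD[OF trans that(1) assms(1,2) that(2) assms(3)] .
  ultimately show ?thesis using assms by blast
qed

lemma down_induct [consumes 2, case_names step]:
  assumes fin: "finite S" and "w \<in> S"
    and step: "\<And>w. w \<in> S \<Longrightarrow> (\<And>u. u \<in> S \<Longrightarrow> le u w \<Longrightarrow> u \<noteq> w \<Longrightarrow> Q u) \<Longrightarrow> Q w"
  shows "Q w"
  using \<open>w \<in> S\<close>
proof (induction "card {v \<in> S. le v w}" arbitrary: w rule: less_induct)
  case less
  show ?case
  proof (rule step[OF less(2)])
    fix u assume u: "u \<in> S" "le u w" "u \<noteq> w"
    have "card {v \<in> S. le v u} < card {v \<in> S. le v w}"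
      using fin u less(2) by (intro psubset_card_mono down_psubset) auto
    then show "Q u" using u(1) by (rule less(1))
  qed
qed

lemma poset_rank_eq:
  assumes fin: "finite S" and b: "is_bot S le b" and r: "rank_function S le r" and x: "x \<in> S"
  shows "poset_rank S le x = r x"
proof -
  have r': "rank_function S le (poset_rank S le)"
    unfolding poset_rank_def by (rule someI[where P = "rank_function S le", OF r])
  show ?thesis using fin x
  proof (induction x rule: down_induct)
    case (step w)
    show ?case
    proof (cases "w = b")
      case True
      then show ?thesis using r r' poset_bot_eq[OF b] by (simp add: rank_function_def)
    next
      case False
      define D where "D = {v \<in> S. le v w \<and> v \<noteq> w}"
      have "finite D" "D \<noteq> {}" using fin b False step(1) by (auto simp: D_def is_bot_def)
      define c where "c = (\<lambda>v. card {u \<in> S. le u v})"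
      have "Max (c ` D) \<in> c ` D" using \<open>finite D\<close> \<open>D \<noteq> {}\<close> by simp
      then obtain m where m: "m \<in> D" "c m = Max (c ` D)" by auto
      have max: "c v \<le> c m" if "v \<in> D" for v using m \<open>finite D\<close> that by simp
      have "covers S le m w"
        unfolding covers_def
      proof (intro conjI ballI impI)
        fix z assume z: "z \<in> S" "le m z \<and> le z w"
        show "z = m \<or> z = w"
        proof (rule ccontr)
          assume n: "\<not> (z = m \<or> z = w)"
          then have "c m < c z"
            unfolding c_def using z m(1) fin by (intro psubset_card_mono down_psubset) (auto simp: D_def)
          moreover have "z \<in> D" using z n by (auto simp: D_def)
          ultimately show False using max[of z] by simp
        qed
      qed (use m step(1) in \<open>auto simp: D_def\<close>)
      then show ?thesis
        using r r' step(2)[of m] m(1) by (auto simp: rank_function_def D_def)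
    qed
  qed
qed

lemma mobius_ex1:
  assumes fin: "finite S" and b: "is_bot S le b"
  shows "\<exists>!f. is_mobius S le f \<and> (\<forall>w. w \<notin> S \<longrightarrow> f w = 0)"
proof -
  note bot = poset_bot_eq[OF b]
  have split: "(\<Sum>u | u \<in> S \<and> le u w. f u) = f w + (\<Sum>u | u \<in> S \<and> le u w \<and> u \<noteq> w. f u)"
    if "w \<in> S" for w and f :: "'a \<Rightarrow> int"
  proof -
    have "{u. u \<in> S \<and> le u w} = insert w {u. u \<in> S \<and> le u w \<and> u \<noteq> w}"
      using that reflp_onD[OF refl that] by blast
    then show ?thesis using fin by simp
  qed
  define R where "R = {(u, w). u \<in> S \<and> w \<in> S \<and> le u w \<and> u \<noteq> w}"
  have wf: "wf R"
    by (rule wf_subset[OF wf_measure[of "\<lambda>w. card {v \<in> S. le v w}"]])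
      (use fin in \<open>clarsimp simp: R_def psubset_card_mono down_psubset\<close>)
  define G where "G = (\<lambda>g w. if w \<notin> S then (0::int) else if w = b then 1
      else - (\<Sum>u | u \<in> S \<and> le u w \<and> u \<noteq> w. g u))"
  define f where "f = wfrec R G"
  have f: "f w = G f w" for w
  proof -
    have "f w = G (cut f R w) w" unfolding f_def by (rule wfrec[OF wf])
    also have "\<dots> = G f w" by (auto simp: G_def cut_def R_def intro!: sum.cong)
    finally show ?thesis .
  qed
  have f0: "f w = 0" if "w \<notin> S" for w using f[of w] that by (simp add: G_def)
  have fb: "f b = 1" using f[of b] b by (simp add: G_def is_bot_def)
  have fs: "f w + (\<Sum>u | u \<in> S \<and> le u w \<and> u \<noteq> w. f u) = 0" if "w \<in> S" "w \<noteq> b" for w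
    using f[of w] that by (simp add: G_def)
  show ?thesis
  proof (rule ex1I[of _ f])
    show "is_mobius S le f \<and> (\<forall>w. w \<notin> S \<longrightarrow> f w = 0)"
      by (simp add: is_mobius_def bot split f0 fb fs)
  next
    fix g assume g: "is_mobius S le g \<and> (\<forall>w. w \<notin> S \<longrightarrow> g w = 0)"
    have "g w = f w" if "w \<in> S" for w
      using fin that
    proof (induction w rule: down_induct)
      case (step w)
      then have "(\<Sum>u | u \<in> S \<and> le u w \<and> u \<noteq> w. g u) = (\<Sum>u | u \<in> S \<and> le u w \<and> u \<noteq> w. f u)"
        by (intro sum.cong) auto
      then show ?case
        using g step(1) split[of w g] fs[of w] fb
        by (cases "w = b") (simp_all add: is_mobius_def bot)
    qed
    moreover have "g w = f w" if "w \<notin> S" for w using f0 g that by simp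
    ultimately show "g = f" by (intro ext) blast
  qed
qed

end

end

theory Submission
  imports Defs
begin

text \<open>Since \<open>y = 0\<close>, the right-hand side is the sum of \<open>(- 1) ^ |w| * t ^ (\<rho>(M) - \<rho> w)\<close> over
  all \<open>w\<close>; grouping by closure, the coefficient belonging to a flat \<open>v\<close> is
  \<open>g v = (\<Sum>w | cl w = v. (- 1) ^ |w|)\<close>. As \<open>cl w \<le> v\<close> iff \<open>w \<le> v\<close>, summing \<open>g\<close> over the flats
  below \<open>v\<close> gives the alternating sum over the Boolean lattice below \<open>v\<close>, which vanishes
  unless \<open>v\<close> is the minimum. Without loops the minimum is a flat and the only element with itself
  as closure, so \<open>g\<close> is the Moebius function of the poset of flats.\<close>

section \<open>Alternating sums over subsets and substitution into polynomials\<close>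

lemma sum_Pow_minus_one_power_card:
  assumes "finite A" "A \<noteq> {}"
  shows "(\<Sum>B\<in>Pow A. (- 1) ^ card B) = (0 :: 'a :: ring_1)"
proof -
  have "card {B. B \<subseteq> A \<and> even (card B)} = card {B. B \<subseteq> A \<and> odd (card B)}"
    using card_subsupersets_even_odd[of A "{}"] assms by auto
  then show ?thesis using assms by (intro sum_alternating_cancels) simp_all
qed

text \<open>Evaluating the outer variable at 0 leaves only the constant coefficient in y, so a
  single one-variable polynomial remains to be composed with \<open>a\<close>.\<close>

lemma subst2_zero_right: "subst2 p a 0 = pcompose (poly p 0) a"
  by (simp add: subst2_def poly_0_coeff_0 coeff_map_poly)

lemma pcompose_power: "pcompose (p ^ n) q = pcompose p q ^ n"
  for p q :: "'a::comm_semiring_1 poly"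
  by (induction n) (simp_all add: pcompose_1 pcompose_mult)

section \<open>Finite posets: maximal elements and Moebius functions\<close>

context poset
begin

lemma exists_maximal_above:
  assumes fin: "finite S" and X: "X \<subseteq> S" "a \<in> X"
  obtains m where "m \<in> maximals X le" "le a m"
proof -
  define Y where "Y = {m \<in> X. le a m}"
  \<comment> \<open>The size of the down-set is strictly monotone, so an element of \<open>Y\<close>
    maximising it is maximal in \<open>Y\<close>, hence also in \<open>X\<close>, as everything in
    \<open>X\<close> above an element of \<open>Y\<close> lies in \<open>Y\<close>.\<close>
  define c where "c = (\<lambda>v. card {u \<in> S. le u v})"
  have "finite Y" "a \<in> Y"
    using X finite_subset[OF X(1) fin] reflp_onD[OF refl, of a] by (auto simp: Y_def)
  then have "Max (c ` Y) \<in> c ` Y" by (intro Max_in) auto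
  then obtain m where m: "m \<in> Y" "c m = Max (c ` Y)" by auto
  have "z = m" if z: "z \<in> X" "le m z" for z
  proof (rule ccontr)
    assume "z \<noteq> m"
    then have "c m < c z"
      unfolding c_def using z m(1) X fin by (intro psubset_card_mono down_psubset) (auto simp: Y_def)
    moreover have "z \<in> Y"
      using z m(1) X transp_onD[OF trans, of a m z] by (auto simp: Y_def)
    ultimately show False using m(2) \<open>finite Y\<close> by (simp add: Max_ge leD)
  qed
  then show thesis using m(1) that by (auto simp: maximals_def Y_def)
qed

lemma poset_subset: "T \<subseteq> S \<Longrightarrow> poset T le"
  using refl trans antisym
  by unfold_locales (blast intro: reflp_on_subset transp_on_subset antisymp_on_subset)+

text \<open>Reduces identifying \<open>mobius\<close> to checking the defining recursion on the
  carrier.\<close>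

lemma mobius_eq:
  assumes "finite S" "is_bot S le b" "is_mobius S le f" "w \<in> S"
  shows "mobius S le w = f w"
proof -
  \<comment> \<open>\<open>mobius\<close> is the unique solution that vanishes off the carrier, so
    \<open>f\<close> is cut off there first.\<close>
  let ?f = "\<lambda>w. if w \<in> S then f w else 0"
  have "is_mobius S le ?f"
    using assms(2,3) poset_bot_eq[OF assms(2)] by (simp add: is_mobius_def is_bot_def cong: conj_cong)
  then have "mobius S le = ?f"
    unfolding mobius_def by (intro the1_equality mobius_ex1[OF assms(1,2)]) simp
  then show ?thesis using assms(4) by simp
qed

end

section \<open>Simplicial posets: atoms, rank and alternating sums\<close>

context simplicial_poset
begin

abbreviation "bottom \<equiv> poset_bot S le"

lemma is_bot: "is_bot S le bottom"
  using has_bot poset_bot_eq by auto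

lemma bot_in: "bottom \<in> S" and bot_le: "x \<in> S \<Longrightarrow> le bottom x"
  using is_bot by (auto simp: is_bot_def)

lemma le_refl: "x \<in> S \<Longrightarrow> le x x"
  using reflp_onD[OF refl] .

lemma le_trans: "x \<in> S \<Longrightarrow> y \<in> S \<Longrightarrow> z \<in> S \<Longrightarrow> le x y \<Longrightarrow> le y z \<Longrightarrow> le x z"
  using transp_onD[OF trans] .

lemma le_antisym: "x \<in> S \<Longrightarrow> y \<in> S \<Longrightarrow> le x y \<Longrightarrow> le y x \<Longrightarrow> x = y"
  using antisymp_onD[OF antisym] .

lemma atoms_subset: "atoms S le \<subseteq> S"
  by (auto simp: atoms_def covers_def)

lemma finite_atoms_below: "finite (atoms_below S le x)"
  using atoms_subset finite by (auto simp: atoms_below_def intro: finite_subset)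

lemma atoms_below_bot: "atoms_below S le bottom = {}"
  using le_antisym bot_in by (auto simp: atoms_below_def atoms_def covers_def)

lemma atoms_below_bij:
  "x \<in> S \<Longrightarrow> bij_betw (atoms_below S le) {y \<in> S. le y x} (Pow (atoms_below S le x))"
  using boolean by blast

lemma atoms_below_subset_iff:
  "x \<in> S \<Longrightarrow> y \<in> S \<Longrightarrow> z \<in> S \<Longrightarrow> le y x \<Longrightarrow> le z x \<Longrightarrow>
    le y z \<longleftrightarrow> atoms_below S le y \<subseteq> atoms_below S le z"
  using boolean[of x] by blast

text \<open>Below \<open>x\<close> the order is inclusion of atom sets, so an empty atom set would
  put \<open>x\<close> below the minimum.\<close>

lemma atoms_below_nonempty:
  assumes "x \<in> S" "x \<noteq> bottom"
  shows "atoms_below S le x \<noteq> {}"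
  using atoms_below_subset_iff[of x x bottom] assms le_refl bot_le bot_in le_antisym
  by (metis empty_subsetI)

text \<open>Rank functions agree on the carrier, so it is enough that counting atoms is one.\<close>

lemma poset_rank_eq_card:
  assumes x: "x \<in> S"
  shows "poset_rank S le x = card (atoms_below S le x)"
proof (rule poset_rank_eq[OF finite is_bot _ x])
  show "rank_function S le (\<lambda>x. card (atoms_below S le x))"
    unfolding rank_function_def
  proof (intro conjI allI impI)
    fix x y assume c: "covers S le x y"
    then have xy: "x \<in> S" "y \<in> S" "le x y" "x \<noteq> y" by (auto simp: covers_def)
    let ?A = "atoms_below S le"
    have sub: "?A x \<subseteq> ?A y" "\<not> ?A y \<subseteq> ?A x"
      using atoms_below_subset_iff[of y] xy le_refl le_antisym by blast+
    then obtain a where a: "a \<in> ?A y" "a \<notin> ?A x" by blast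
    \<comment> \<open>Every set of atoms below \<open>y\<close> is realised by an element below
      \<open>y\<close>. The one realising \<open>insert a (?A x)\<close> lies strictly above
      \<open>x\<close>, so the covering relation forces it to be \<open>y\<close>.\<close>
    then have "insert a (?A x) \<in> ?A ` {z \<in> S. le z y}"
      using atoms_below_bij[OF xy(2)] sub by (simp add: bij_betw_def)
    then obtain z where z: "z \<in> S" "le z y" "?A z = insert a (?A x)" by auto
    then have "le x z" using atoms_below_subset_iff[of y x z] xy by auto
    then have "z = y" using c z a by (auto simp: covers_def)
    then show "card (?A y) = Suc (card (?A x))"
      using z a finite_atoms_below by simp
  qed (simp add: atoms_below_bot)
qed

lemma poset_rank_bot: "poset_rank S le bottom = 0"
  by (simp add: poset_rank_eq_card bot_in atoms_below_bot)

lemma sum_minus_one_power_rank: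
  assumes "x \<in> S" "x \<noteq> bottom"
  shows "(\<Sum>w | w \<in> S \<and> le w x. (- 1) ^ poset_rank S le w) = (0 :: 'b :: ring_1)"
proof -
  have "(\<Sum>w | w \<in> S \<and> le w x. (- 1) ^ poset_rank S le w :: 'b) =
      (\<Sum>w | w \<in> S \<and> le w x. (- 1) ^ card (atoms_below S le w))"
    by (intro sum.cong) (auto simp: poset_rank_eq_card)
  also have "\<dots> = (\<Sum>B\<in>Pow (atoms_below S le x). (- 1) ^ card B)"
    using atoms_below_bij[OF assms(1)] by (rule sum.reindex_bij_betw)
  also have "\<dots> = 0"
    using assms by (intro sum_Pow_minus_one_power_card finite_atoms_below atoms_below_nonempty)
  finally show ?thesis .
qed

end

section \<open>Matroid schemes: closure and flats\<close>

context matroid_scheme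
begin

abbreviation "cl \<equiv> closure S le \<rho>"
abbreviation "\<F> \<equiv> flats S le \<rho>"

text \<open>A maximal common lower bound \<open>l\<close> of \<open>y\<close> and \<open>v\<close>
  above \<open>x\<close> has rank squeezed between \<rho>(x) and \<rho>(y), which are equal. So
  \<open>M4\<close> provides a join of \<open>y\<close> and \<open>v\<close>, and \<open>M3\<close>
  bounds its rank by that of \<open>v\<close>. This gives both the uniqueness of closures and the
  adjunction \<open>closure_le_iff\<close>.\<close>

lemma exists_upper_bound_rank:
  assumes S: "x \<in> S" "y \<in> S" "v \<in> S" and le: "le x y" "le x v" and eq: "\<rho> y = \<rho> x"
  obtains u where "u \<in> S" "le y u" "le v u" "\<rho> u = \<rho> v"
proof -
  obtain l where l: "l \<in> meets S le y v" "le x l"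
    using exists_maximal_above[OF finite, of "{l \<in> S. le l y \<and> le l v}" x] S le
    by (auto simp: meets_def)
  then have l': "l \<in> S" "le l y" by (auto simp: meets_def maximals_def)
  have \<rho>l: "\<rho> y = \<rho> l" using M2[of x l] M2[of l y] l l' S eq by simp
  then obtain u where u: "u \<in> joins S le y v" using M4[OF S(2,3) l(1)] by auto
  then have u': "u \<in> S" "le y u" "le v u" by (auto simp: joins_def minimals_def)
  have "\<rho> u = \<rho> v"
    using M3[OF S(2,3) u l(1)] \<rho>l M2[of v u] S u' by simp
  then show thesis using that u' by blast
qed

text \<open>Justifies the definite description in \<open>closure\<close>: two maximal candidates
  have a common upper bound of the same rank, with which both must coincide.\<close>

lemma closure_in_maximals:
  assumes x: "x \<in> S"
  shows "cl x \<in> maximals {z \<in> S. le x z \<and> \<rho> z = \<rho> x} le"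
proof -
  let ?X = "{z \<in> S. le x z \<and> \<rho> z = \<rho> x}"
  obtain y where y: "y \<in> maximals ?X le"
    using exists_maximal_above[OF finite, of ?X x] x le_refl by auto
  have unique: "z = y" if z: "z \<in> maximals ?X le" for z
  proof -
    from y z have "y \<in> ?X" "z \<in> ?X" by (auto simp: maximals_def)
    then obtain u where u: "u \<in> S" "le y u" "le z u" "\<rho> u = \<rho> z"
      using exists_upper_bound_rank[of x y z] x by auto
    then have "u \<in> ?X" using \<open>z \<in> ?X\<close> le_trans[of x z u] x by auto
    then show "z = y" using y z u by (auto simp: maximals_def)
  qed
  show ?thesis
    unfolding closure_def
    by (rule theI[where P = "\<lambda>y. y \<in> maximals ?X le", OF y unique])
qed

lemma closure_in: "x \<in> S \<Longrightarrow> cl x \<in> S"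
  and le_closure: "x \<in> S \<Longrightarrow> le x (cl x)"
  and rank_closure: "x \<in> S \<Longrightarrow> \<rho> (cl x) = \<rho> x"
  using closure_in_maximals[of x] by (auto simp: maximals_def)

text \<open>Replaces the definite description by the condition that the rank changes at every
  element strictly above.\<close>

lemma flat_iff:
  "v \<in> \<F> \<longleftrightarrow> v \<in> S \<and> (\<forall>u\<in>S. le v u \<and> \<rho> u = \<rho> v \<longrightarrow> u = v)"
proof
  assume v: "v \<in> \<F>"
  then have "v \<in> maximals {z \<in> S. le v z \<and> \<rho> z = \<rho> v} le"
    using closure_in_maximals[of v] by (simp add: flats_def)
  then show "v \<in> S \<and> (\<forall>u\<in>S. le v u \<and> \<rho> u = \<rho> v \<longrightarrow> u = v)"
    by (auto simp: maximals_def)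
next
  assume "v \<in> S \<and> (\<forall>u\<in>S. le v u \<and> \<rho> u = \<rho> v \<longrightarrow> u = v)"
  then show "v \<in> \<F>"
    using closure_in le_closure rank_closure by (auto simp: flats_def)
qed

lemma flats_subset: "\<F> \<subseteq> S"
  by (auto simp: flats_def)

lemma finite_flats: "finite \<F>"
  using finite_subset[OF flats_subset finite] .

lemma closure_flat: "x \<in> S \<Longrightarrow> cl x \<in> \<F>"
  using closure_in_maximals[of x] le_trans[of x "cl x"] by (auto simp: flat_iff maximals_def)

text \<open>For the nontrivial direction, \<open>cl x\<close> and \<open>v\<close> have a common
  upper bound of the same rank as \<open>v\<close>; since \<open>v\<close> is a flat, that bound is
  \<open>v\<close> itself.\<close>

lemma closure_le_iff:
  assumes x: "x \<in> S" and v: "v \<in> \<F>"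
  shows "le (cl x) v \<longleftrightarrow> le x v"
proof
  have vS: "v \<in> S" using v flats_subset by blast
  show "le x v" if "le (cl x) v"
    using that x vS closure_in le_closure le_trans by blast
  assume "le x v"
  then obtain u where "u \<in> S" "le (cl x) u" "le v u" "\<rho> u = \<rho> v"
    using exists_upper_bound_rank[of x "cl x" v] x vS closure_in le_closure rank_closure by metis
  then show "le (cl x) v" using v by (auto simp: flat_iff)
qed

section \<open>The rank of the scheme and the minimum of the flats\<close>

lemma maximal_rank_max:
  assumes m: "m \<in> maximals S le" and w: "w \<in> S"
  shows "\<rho> w \<le> \<rho> m"
proof (rule ccontr)
  assume "\<not> \<rho> w \<le> \<rho> m"
  \<comment> \<open>The join \<open>u\<close> is above \<open>m\<close> and above an atom not below
    \<open>m\<close>, hence strictly above the maximal element \<open>m\<close>.\<close>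
  then obtain a u where "\<not> le a m" "u \<in> joins S le m a"
    using M5[of m w] m w by (auto simp: maximals_def)
  then show False using m by (auto simp: joins_def minimals_def maximals_def)
qed

lemma some_maximal: "(SOME x. x \<in> maximals S le) \<in> maximals S le"
  using exists_maximal_above[OF finite subset_refl bot_in] by (metis someI)

lemma rank_le_scheme_rank: "w \<in> S \<Longrightarrow> \<rho> w \<le> scheme_rank S le \<rho>"
  unfolding scheme_rank_def by (rule maximal_rank_max[OF some_maximal])

text \<open>Maximal elements are flats, so the largest rank is already attained on a flat.\<close>

lemma Max_rank_flats: "Max (\<rho> ` \<F>) = scheme_rank S le \<rho>"
proof (rule Max_eqI)
  show "y \<le> scheme_rank S le \<rho>" if "y \<in> \<rho> ` \<F>" for y
    using that flats_subset rank_le_scheme_rank by auto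
  have "(SOME x. x \<in> maximals S le) \<in> \<F>"
    using some_maximal by (auto simp: flat_iff maximals_def)
  then show "scheme_rank S le \<rho> \<in> \<rho> ` \<F>" by (simp add: scheme_rank_def)
qed (simp add: finite_flats)

lemma rank_bot: "\<rho> bottom = 0"
  using M1[OF bot_in] poset_rank_bot by simp

text \<open>An element other than the minimum lies above an atom, which has positive rank when there
  are no loops; monotonicity carries this up.\<close>

lemma rank_eq_0_iff:
  assumes "loops S le \<rho> = {}" "x \<in> S"
  shows "\<rho> x = 0 \<longleftrightarrow> x = bottom"
proof
  assume 0: "\<rho> x = 0"
  show "x = bottom"
  proof (rule ccontr)
    assume "x \<noteq> bottom"
    then obtain a where a: "a \<in> atoms S le" "le a x"
      using atoms_below_nonempty[OF assms(2)] by (auto simp: atoms_below_def)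
    then have "\<rho> a = 0" using M2[of a x] 0 atoms_subset assms(2) by auto
    then show False using a assms(1) by (auto simp: loops_def)
  qed
qed (simp add: rank_bot)

lemma is_bot_flats:
  assumes "loops S le \<rho> = {}"
  shows "is_bot \<F> le bottom"
  using rank_eq_0_iff[OF assms] bot_in bot_le flats_subset by (auto simp: is_bot_def flat_iff rank_bot)

section \<open>Moebius function and characteristic polynomial of the flats\<close>

lemma mobius_flats:
  assumes noloops: "loops S le \<rho> = {}" and v: "v \<in> \<F>"
  shows "mobius \<F> le v = (\<Sum>w | w \<in> S \<and> cl w = v. (- 1) ^ poset_rank S le w)"
proof -
  interpret F: poset \<F> le by (rule poset_subset[OF flats_subset])
  note bot = is_bot_flats[OF noloops]
  let ?g = "\<lambda>v. \<Sum>w | w \<in> S \<and> cl w = v. (- 1) ^ poset_rank S le w :: int"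
  have "is_mobius \<F> le ?g"
    unfolding is_mobius_def F.poset_bot_eq[OF bot]
  proof (intro conjI ballI impI)
    \<comment> \<open>Closure preserves rank, and only the minimum has rank 0.\<close>
    have "w = bottom" if "w \<in> S" "cl w = bottom" for w
      using that rank_closure[of w] rank_eq_0_iff[OF noloops, of w] rank_bot by simp
    then have "{w. w \<in> S \<and> cl w = bottom} = {bottom}"
      using bot by (auto simp: is_bot_def flats_def)
    then show "?g bottom = 1" by (simp add: poset_rank_bot)
  next
    fix v assume v: "v \<in> \<F>" "v \<noteq> bottom"
    let ?D = "{w. w \<in> S \<and> le w v}" and ?E = "{u. u \<in> \<F> \<and> le u v}"
    \<comment> \<open>For a flat \<open>u\<close> below \<open>v\<close>, every \<open>w\<close>
      with closure \<open>u\<close> is itself below \<open>v\<close>, so the restriction to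
      \<open>?D\<close> changes nothing and puts the sum in the form regrouped by
      \<open>sum.group\<close>.\<close>
    have "sum ?g ?E = (\<Sum>u\<in>?E. \<Sum>w | w \<in> ?D \<and> cl w = u. (- 1) ^ poset_rank S le w)"
      using closure_le_iff[OF _ v(1)] by (intro sum.cong) auto
    also have "\<dots> = (\<Sum>w\<in>?D. (- 1) ^ poset_rank S le w)"
      using finite finite_flats closure_flat closure_le_iff[OF _ v(1)]
      by (intro sum.group) auto
    also have "\<dots> = 0" using v flats_subset by (intro sum_minus_one_power_rank) auto
    finally show "sum ?g ?E = 0" .
  qed
  then show ?thesis by (rule F.mobius_eq[OF finite_flats bot _ v])
qed

text \<open>Every \<open>w\<close> with closure \<open>v\<close> has the rank of \<open>v\<close>,
  so the power of t can be moved inside the sum giving the Moebius value; the fibres of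
  \<open>cl\<close> then partition \<open>S\<close>.\<close>

lemma poset_char_poly_flats:
  assumes "loops S le \<rho> = {}"
  shows "poset_char_poly \<F> le \<rho> =
    (\<Sum>w\<in>S. (- 1) ^ poset_rank S le w * [:0, 1:] ^ (scheme_rank S le \<rho> - \<rho> w))"
proof -
  let ?R = "scheme_rank S le \<rho>"
  let ?h = "\<lambda>w. (- 1) ^ poset_rank S le w * [:0, 1:] ^ (?R - \<rho> w) :: int poly"
  have "monom (mobius \<F> le v) (?R - \<rho> v) = (\<Sum>w | w \<in> S \<and> cl w = v. ?h w)" if "v \<in> \<F>" for v
  proof -
    have "monom (mobius \<F> le v) (?R - \<rho> v) = of_int (mobius \<F> le v) * [:0, 1:] ^ (?R - \<rho> v)"
      by (simp add: monom_altdef of_int_poly)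
    also have "\<dots> = (\<Sum>w | w \<in> S \<and> cl w = v. (- 1) ^ poset_rank S le w * [:0, 1:] ^ (?R - \<rho> v))"
      by (simp add: mobius_flats[OF assms that] sum_distrib_right)
    also have "\<dots> = (\<Sum>w | w \<in> S \<and> cl w = v. ?h w)"
      using rank_closure by (intro sum.cong) auto
    finally show ?thesis .
  qed
  then have "poset_char_poly \<F> le \<rho> = (\<Sum>v\<in>\<F>. \<Sum>w | w \<in> S \<and> cl w = v. ?h w)"
    by (simp add: poset_char_poly_def Max_rank_flats)
  also have "\<dots> = sum ?h S"
    using finite finite_flats closure_flat by (intro sum.group) auto
  finally show ?thesis .
qed

section \<open>The specialised Tutte polynomial\<close>

lemma subst2_tutte_poly:
  "(- 1) ^ scheme_rank S le \<rho> * subst2 (tutte_poly S le \<rho>) (1 - [:0, 1:]) 0 =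
    (\<Sum>w\<in>S. (- 1) ^ poset_rank S le w * [:0, 1:] ^ (scheme_rank S le \<rho> - \<rho> w))"
proof -
  let ?R = "scheme_rank S le \<rho>" and ?X = "[:0, 1:] :: int poly"
  have "(- 1) ^ ?R * ((- ?X) ^ (?R - \<rho> w) * (- 1) ^ (poset_rank S le w - \<rho> w)) =
      (- 1) ^ poset_rank S le w * ?X ^ (?R - \<rho> w)" if w: "w \<in> S" for w
  proof -
    \<comment> \<open>Both truncated differences are genuine. With \<open>j\<close> and
      \<open>k\<close> for them, the total sign exponent is \<rho>(w) + 2j + k, which has the parity
      of \<rho>(w) + k, the rank of \<open>w\<close>.\<close>
    obtain k where k: "poset_rank S le w = \<rho> w + k"
      using M1[OF w] le_Suc_ex by blast
    obtain j where j: "?R = \<rho> w + j"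
      using rank_le_scheme_rank[OF w] le_Suc_ex by blast
    have "(- ?X) ^ j = (- 1) ^ j * ?X ^ j" by (rule power_minus)
    moreover have "(- 1) ^ j * (- 1) ^ j = (1 :: int poly)"
      by (simp flip: power_mult_distrib)
    ultimately show ?thesis by (simp add: j k power_add algebra_simps)
  qed
  moreover have "subst2 (tutte_poly S le \<rho>) (1 - ?X) 0 =
      (\<Sum>w\<in>S. (- ?X) ^ (?R - \<rho> w) * (- 1) ^ (poset_rank S le w - \<rho> w))"
  proof -
    \<comment> \<open>The factor x - 1 becomes (1 - t) - 1 = -t, and y - 1 becomes the constant -1
      at y = 0, which composition fixes.\<close>
    have "pcompose (?X - 1) (1 - ?X) = - ?X"
      by (simp add: pcompose_diff pcompose_1 pcompose_pCons)
    moreover have "pcompose (- 1) (1 - ?X) = - 1"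
      by (simp add: pcompose_uminus pcompose_1)
    ultimately show ?thesis
      by (simp add: subst2_zero_right tutte_poly_def poly_sum varX_def varY_def
          pcompose_sum pcompose_mult pcompose_power)
  qed
  ultimately show ?thesis by (simp add: sum_distrib_left)
qed

end

theorem theorem11p2:
  fixes S :: "'a set" and le :: "'a \<Rightarrow> 'a \<Rightarrow> bool" and \<rho> :: "'a \<Rightarrow> nat"
  assumes "matroid_scheme S le \<rho>"
    and "loops S le \<rho> = {}"
  shows "poset_char_poly (flats S le \<rho>) le \<rho> =
    (- 1) ^ scheme_rank S le \<rho> * subst2 (tutte_poly S le \<rho>) (1 - [:0, 1:]) 0"
proof -
  interpret matroid_scheme S le \<rho> by fact
  show ?thesis using poset_char_poly_flats[OF assms(2)] subst2_tutte_poly by simp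
qed

end
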